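(* Let $n,N\ge 1$ be integers, let $\omega_1,\dots,\omega_N>0$, $\lambda>0$, and $x_1,\dots,x_N\in\mathbb{R}^n$. For every $i\in\{1,\dots,N\}$ put $\lambda_i=\lambda\omega_i$ and $\alpha_i=\omega_i\|x_i\|^2$. Let $\ell_1,\dots,\ell_N$ be an enumeration of $\{1,\dots,N\}$ such that $\alpha_{\ell_1}\le\cdots\le\alpha_{\ell_N}$, and assume $\alpha_{\ell_N}>0$. Let $I_0:=\emptyset$ and $I_i:=\{\ell_1,\dots,\ell_i\}$ for all $i\in\{1,\dots,N\}$. Define $$k:=\min\left\{i\in\{0,\dots,N-1\} : \Big(2+\sum_{j\notin I_i}\frac{1}{\lambda_j}\Big)\sqrt{\alpha_{\ell_{i+1}}}>\sum_{j\notin I_i}\frac{\sqrt{\alpha_j}}{\lambda_j}\right\}.$$ Then $\overline{p}\in\mathbb{R}^N$ defined by $$(\forall i\in\{1,\dots,N\})\quad \overline{p}_i=\begin{cases}0, & \text{if } i\in I_k;\\[4pt] \dfrac{1}{2\lambda_i}\left[\dfrac{\big(2+\sum_{j\notin I_k}\frac{1}{\lambda_j}\big)\sqrt{\alpha_i}}{\sum_{j\notin I_k}\frac{\sqrt{\alpha_j}}{\lambda_j}}-1\right], & \text{if } i\notin I_k\end{cases}$$ is a solution to the problem $$\max_{p\in\Delta_N}\ \sum_{i=1}^{N}\frac{\alpha_i p_i}{1+2\lambda_i p_i}.$$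
   Context: $\|\cdot\|$ is the Euclidean norm. $\Delta_N=\{p\in\mathbb{R}^N : p_i\ge 0 \text{ for all } i,\ \sum_{i=1}^N p_i=1\}$ is the probability simplex. Sums over $j\notin I_i$ are over $j\in\{1,\dots,N\}\setminus I_i$. *)

theory Defs
  imports "HOL-Analysis.Analysis"
begin

definition prob_simplex :: "(real ^ 'N::finite) set" where
  "prob_simplex = {p. (\<forall>i. p $ i \<ge> 0) \<and> (\<Sum>i\<in>UNIV. p $ i) = 1}"

end

theory Submission
  imports Defs
begin

text \<open>
  Put \<open>t = B / A\<close>, where \<open>A\<close> and \<open>B\<close> are the two sums over the complement of \<open>I k\<close>, with
  the summand 2 included in \<open>A\<close>. Then \<open>t\<^sup>2\<close> is the Lagrange multiplier of the constraint \<open>\<Sum>i. p i = 1\<close>: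
  the choice of \<open>k\<close> says precisely that the indices outside \<open>I k\<close> are those with
  \<open>sqrt (\<alpha> i) > t\<close>, so that \<open>pbar i\<close> is the positive part of \<open>(sqrt (\<alpha> i) / t - 1) / (2 * lams i)\<close>,
  which maximizes \<open>\<alpha> i * q / (1 + 2 * lams i * q) - t\<^sup>2 * q\<close> over \<open>q \<ge> 0\<close>. Summing over \<open>i\<close>
  cancels the multiplier terms.
\<close>

text \<open>If \<open>s \<le> t\<close>, dropping the denominator bounds the value by (s^2 - t^2) q,
  hence by 0, which \<open>p = 0\<close> attains. If \<open>s > t\<close>, the substitution u = 1 +
  2 c q turns the value into a constant minus (s^2/u + t^2 u) / (2 c), and AM-GM gives s^2/u + t^2 u
  >= 2 s t with equality at u = s/t, the point corresponding to \<open>p\<close>.\<close>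

lemma lagrangian_term_max:
  fixes s c t q :: real
  assumes "s \<ge> 0" "c > 0" "t > 0" "q \<ge> 0"
  defines "p \<equiv> max 0 ((s / t - 1) / (2 * c))"
  shows "s\<^sup>2 * q / (1 + 2 * c * q) - t\<^sup>2 * q \<le> s\<^sup>2 * p / (1 + 2 * c * p) - t\<^sup>2 * p"
proof (cases "s \<le> t")
  case True
  have "p = 0"
    using True assms by (simp add: p_def max_def divide_le_0_iff zero_le_divide_iff)
  have "s\<^sup>2 * q / (1 + 2 * c * q) \<le> s\<^sup>2 * q / 1"
    using assms by (intro divide_left_mono mult_pos_pos add_pos_nonneg) auto
  also have "\<dots> \<le> t\<^sup>2 * q"
    using True assms by (simp add: mult_right_mono power_mono)
  finally show ?thesis
    using \<open>p = 0\<close> by simp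
next
  case False
  define u where "u = 1 + 2 * c * q"
  have "u > 0"
    unfolding u_def using assms by (intro add_pos_nonneg) auto
  \<comment> \<open>Kept general in \<open>v\<close> because it serves twice: at \<open>u\<close>
    for the competitor \<open>q\<close> and at \<open>s / t\<close> for \<open>p\<close>.\<close>
  have split_u: "s\<^sup>2 * ((v - 1) / (2 * c)) / v - t\<^sup>2 * ((v - 1) / (2 * c))
      = (s\<^sup>2 + t\<^sup>2 - (s\<^sup>2 / v + t\<^sup>2 * v)) / (2 * c)" if "v > 0" for v
    using that \<open>c > 0\<close> by (simp add: field_simps)
  have p: "p = (s / t - 1) / (2 * c)"
    using False assms by (simp add: p_def max_def)
  have v: "1 + 2 * c * p = s / t"
    using \<open>c > 0\<close> by (simp add: p)
  have "q = (u - 1) / (2 * c)"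
    using \<open>c > 0\<close> by (simp add: u_def)
  then have "s\<^sup>2 * q / (1 + 2 * c * q) - t\<^sup>2 * q = (s\<^sup>2 + t\<^sup>2 - (s\<^sup>2 / u + t\<^sup>2 * u)) / (2 * c)"
    using split_u[OF \<open>u > 0\<close>] by (simp add: u_def)
  also have "\<dots> \<le> (s\<^sup>2 + t\<^sup>2 - 2 * s * t) / (2 * c)"
  proof -
    have "s\<^sup>2 / u + t\<^sup>2 * u - 2 * s * t = (s - t * u)\<^sup>2 / u"
      using \<open>u > 0\<close> by (simp add: field_simps power2_eq_square)
    also have "\<dots> \<ge> 0"
      using \<open>u > 0\<close> by simp
    finally show ?thesis
      using \<open>c > 0\<close> by (simp add: divide_right_mono)
  qed
  also have "\<dots> = (s\<^sup>2 + t\<^sup>2 - (s\<^sup>2 / (s / t) + t\<^sup>2 * (s / t))) / (2 * c)"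
    using False \<open>t > 0\<close> by (simp add: field_simps power2_eq_square)
  also have "\<dots> = s\<^sup>2 * p / (1 + 2 * c * p) - t\<^sup>2 * p"
    using split_u[of "s / t"] False \<open>t > 0\<close> by (simp add: v flip: p)
  finally show ?thesis .
qed

text \<open>The sufficiency half of the multiplier rule. One \<open>t\<close> serves all indices, so
  the penalty totals t^2 for every point of the simplex. For \<open>pbar\<close> it then remains to
  check the positive-part formula and the normalization.\<close>

lemma is_arg_max_water_filling:
  fixes a c :: "'N::finite \<Rightarrow> real" and p :: "real ^ 'N"
  assumes a: "\<And>i. a i \<ge> 0" and c: "\<And>i. c i > 0" and t: "t > 0"
    and p: "\<And>i. p $ i = max 0 ((sqrt (a i) / t - 1) / (2 * c i))"
    and p_sum: "(\<Sum>i\<in>UNIV. p $ i) = 1"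
  shows "is_arg_max (\<lambda>p. \<Sum>i\<in>UNIV. a i * p $ i / (1 + 2 * c i * p $ i))
           (\<lambda>p. p \<in> prob_simplex) p"
proof -
  have "(\<Sum>i\<in>UNIV. a i * q $ i / (1 + 2 * c i * q $ i))
      \<le> (\<Sum>i\<in>UNIV. a i * p $ i / (1 + 2 * c i * p $ i))" if "q \<in> prob_simplex" for q
  proof -
    have q: "q $ i \<ge> 0" "(\<Sum>i\<in>UNIV. q $ i) = 1" for i
      using that by (auto simp: prob_simplex_def)
    have "(\<Sum>i\<in>UNIV. a i * q $ i / (1 + 2 * c i * q $ i) - t\<^sup>2 * q $ i)
        \<le> (\<Sum>i\<in>UNIV. a i * p $ i / (1 + 2 * c i * p $ i) - t\<^sup>2 * p $ i)"
      using lagrangian_term_max[of "sqrt (a _)" "c _" t "q $ _"] a c t q(1)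
      by (intro sum_mono) (simp add: p)
    then show ?thesis
      by (simp add: sum_subtractf q(2) p_sum flip: sum_distrib_left)
  qed
  moreover have "p \<in> prob_simplex"
    by (simp add: prob_simplex_def p_sum) (simp add: p)
  ultimately show ?thesis
    by (auto simp: is_arg_max_def not_less)
qed

theorem proposition2p2:
  fixes \<omega> :: "'N::finite \<Rightarrow> real"
    and lam :: real
    and x :: "'N \<Rightarrow> real ^ 'n::finite"
    and lams \<alpha> :: "'N \<Rightarrow> real"
    and N k :: nat
    and l :: "nat \<Rightarrow> 'N"
    and I :: "nat \<Rightarrow> 'N set"
    and pbar :: "real ^ 'N"
  assumes N: "N = CARD('N)"
    and omega_pos: "\<And>i. \<omega> i > 0"
    and lam_pos: "lam > 0"
    and lams: "\<And>i. lams i = lam * \<omega> i"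
    and alpha: "\<And>i. \<alpha> i = \<omega> i * (norm (x i))\<^sup>2"
    and l_enum: "bij_betw l {1..N} UNIV"
    and l_sorted: "\<And>i. 1 \<le> i \<Longrightarrow> i < N \<Longrightarrow> \<alpha> (l i) \<le> \<alpha> (l (i + 1))"
    and alpha_max_pos: "\<alpha> (l N) > 0"
    and I_0: "I 0 = {}"
    and I_i: "\<And>i. 1 \<le> i \<Longrightarrow> i \<le> N \<Longrightarrow> I i = l ` {1..i}"
    and k: "k = Min {i \<in> {0..N - 1}.
              (2 + (\<Sum>j\<in>- I i. 1 / lams j)) * sqrt (\<alpha> (l (i + 1)))
                > (\<Sum>j\<in>- I i. sqrt (\<alpha> j) / lams j)}"
    and pbar: "\<And>i. pbar $ i =
              (if i \<in> I k then 0
               else 1 / (2 * lams i) *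
                 ((2 + (\<Sum>j\<in>- I k. 1 / lams j)) * sqrt (\<alpha> i)
                    / (\<Sum>j\<in>- I k. sqrt (\<alpha> j) / lams j) - 1))"
  shows "is_arg_max (\<lambda>p. \<Sum>i\<in>UNIV. \<alpha> i * p $ i / (1 + 2 * lams i * p $ i))
           (\<lambda>p. p \<in> prob_simplex) pbar"
proof -
  define A where "A m = 2 + (\<Sum>j\<in>- I m. 1 / lams j)" for m
  define B where "B m = (\<Sum>j\<in>- I m. sqrt (\<alpha> j) / lams j)" for m
  define K where "K = {i \<in> {0..N - 1}. A i * sqrt (\<alpha> (l (i + 1))) > B i}"
  have lams_pos: "lams i > 0" for i
    by (simp add: lams lam_pos omega_pos)
  have \<alpha>_nonneg: "\<alpha> i \<ge> 0" for i
    using omega_pos[of i] by (simp add: alpha)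
  have "N \<ge> 1"
    by (simp add: N Suc_leI)
  have l_inj: "inj_on l {1..N}" and l_surj: "l ` {1..N} = UNIV"
    using l_enum by (auto simp: bij_betw_def)
  have I_eq: "I m = l ` {1..m}" if "m \<le> N" for m
    using that I_0 I_i[of m] by (cases "m = 0") auto
  have l_in_I: "l m \<in> I m' \<longleftrightarrow> m \<le> m'" if "m \<in> {1..N}" "m' \<le> N" for m m'
    using that inj_onD[OF l_inj] by (fastforce simp: I_eq)
  have \<alpha>_mono: "\<alpha> (l a) \<le> \<alpha> (l b)" if "1 \<le> a" "a \<le> b" "b \<le> N" for a b
    using that(2,3,1)
  proof (induction b rule: dec_induct)
    case (step b)
    then show ?case
      using l_sorted[of b] by simp
  qed simp
  have A_ge: "A m \<ge> 2" for m
    using lams_pos by (simp add: A_def sum_nonneg less_imp_le)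
  \<comment> \<open>Passing from \<open>m\<close> to \<open>Suc m\<close> removes the single index
    \<open>l (Suc m)\<close>. Its contributions to both sides of the test defining \<open>K\<close>
    are equal, so the test at \<open>m\<close> may be read with \<open>A (Suc m)\<close> and
    \<open>B (Suc m)\<close> instead.\<close>
  have AB_Suc: "A m = A (Suc m) + 1 / lams (l (Suc m))"
      "B m = B (Suc m) + sqrt (\<alpha> (l (Suc m))) / lams (l (Suc m))" if "Suc m \<le> N" for m
  proof -
    have "I (Suc m) = insert (l (Suc m)) (I m)"
      using that by (simp add: I_eq atLeastAtMostSuc_conv)
    moreover have "l (Suc m) \<notin> I m"
      using that by (simp add: l_in_I)
    ultimately have "- I m = insert (l (Suc m)) (- I (Suc m))" "l (Suc m) \<notin> - I (Suc m)"
      by auto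
    then show "A m = A (Suc m) + 1 / lams (l (Suc m))"
      "B m = B (Suc m) + sqrt (\<alpha> (l (Suc m))) / lams (l (Suc m))"
      by (simp_all add: A_def B_def)
  qed
  have "I N = UNIV"
    using I_eq[of N] l_surj by simp
  \<comment> \<open>\<open>A N = 2\<close> and \<open>B N = 0\<close>, so after cancellation the
    test at \<open>N - 1\<close> says that twice the square root of the largest \<alpha> is
    positive. Hence the minimum is over a nonempty set.\<close>
  then have "N - 1 \<in> K"
    using AB_Suc[of "N - 1"] \<open>N \<ge> 1\<close> alpha_max_pos
    by (simp add: K_def A_def B_def distrib_right)
  have "k = Min K"
    by (simp add: k K_def A_def B_def)
  moreover have "finite K"
    by (simp add: K_def)
  ultimately have k_le: "k \<le> m" if "m \<in> K" for m
    using that by simp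
  have "k \<in> K"
    using \<open>k = Min K\<close> \<open>finite K\<close> \<open>N - 1 \<in> K\<close> Min_in by blast
  then have "k < N" and k_gt: "A k * sqrt (\<alpha> (l (Suc k))) > B k"
    using \<open>N \<ge> 1\<close> by (auto simp: K_def)
  have "B k > 0"
    unfolding B_def
  \<comment> \<open>Since \<open>k < N\<close>, the index \<open>l N\<close> of the largest \<alpha>
    is still in the sum.\<close>
  proof (rule sum_pos2)
    show "l N \<in> - I k"
      using \<open>k < N\<close> by (simp add: l_in_I)
  qed (use alpha_max_pos lams_pos \<alpha>_nonneg in \<open>auto simp: less_imp_le\<close>)
  have "A k > 0"
    using A_ge[of k] by linarith
  define t where "t = B k / A k"
  have "t > 0"
    using \<open>A k > 0\<close> \<open>B k > 0\<close> by (simp add: t_def)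
  have gt_t: "sqrt (\<alpha> i) > t" if "i \<notin> I k" for i
  proof -
    obtain m where m: "m \<in> {1..N}" "i = l m"
      using l_surj by blast
    with that \<open>k < N\<close> have "Suc k \<le> m"
      by (simp add: l_in_I)
    then have "sqrt (\<alpha> (l (Suc k))) \<le> sqrt (\<alpha> i)"
      using \<alpha>_mono[of "Suc k" m] m by simp
    \<comment> \<open>This is the test at \<open>k\<close> divided by \<open>A k\<close>; the
      ordering extends it to all later indices.\<close>
    moreover have "t < sqrt (\<alpha> (l (Suc k)))"
      using k_gt \<open>A k > 0\<close> by (simp add: t_def field_simps)
    ultimately show ?thesis
      by linarith
  qed
  have le_t: "sqrt (\<alpha> i) \<le> t" if "i \<in> I k" for i
  proof -
    obtain m where m: "m \<in> {1..k}" "i = l m"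
      using \<open>i \<in> I k\<close> I_eq[of k] \<open>k < N\<close> by auto
    \<comment> \<open>As \<open>I k\<close> has an element, \<open>k\<close> is not 0; by minimality
      its predecessor fails the test.\<close>
    then obtain k' where k': "k = Suc k'"
      by (cases k) auto
    have "k' \<notin> K"
      using k_le[of k'] k' by auto
    then have "A k' * sqrt (\<alpha> (l k)) \<le> B k'"
      using \<open>k < N\<close> k' by (simp add: K_def not_less)
    \<comment> \<open>The term of \<open>l k\<close> cancels from the failed test, which turns it
      into a comparison with the same \<open>t\<close>.\<close>
    then have "A k * sqrt (\<alpha> (l k)) \<le> B k"
      using AB_Suc[of k'] \<open>k < N\<close> k' by (simp add: distrib_right)
    then have "sqrt (\<alpha> (l k)) \<le> t"
      using \<open>A k > 0\<close> by (simp add: t_def field_simps)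
    moreover have "sqrt (\<alpha> i) \<le> sqrt (\<alpha> (l k))"
      using \<alpha>_mono[of m k] m \<open>k < N\<close> by simp
    ultimately show ?thesis
      by linarith
  qed
  have pbar_inside: "pbar $ i = 0" if "i \<in> I k" for i
    using that by (simp add: pbar)
  have pbar_outside: "pbar $ i = (sqrt (\<alpha> i) / t - 1) / (2 * lams i)" if "i \<notin> I k" for i
    using that by (simp add: pbar t_def flip: A_def B_def)
  have "pbar $ i = max 0 ((sqrt (\<alpha> i) / t - 1) / (2 * lams i))" for i
  proof (cases "i \<in> I k")
    case True
    then have "(sqrt (\<alpha> i) / t - 1) / (2 * lams i) \<le> 0"
      using le_t[of i] lams_pos[of i] \<open>t > 0\<close> by (simp add: divide_le_0_iff)
    with True show ?thesis
      by (simp add: pbar_inside)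
  next
    case False
    then have "(sqrt (\<alpha> i) / t - 1) / (2 * lams i) \<ge> 0"
      using gt_t[of i] lams_pos[of i] \<open>t > 0\<close> by simp
    with False show ?thesis
      by (simp add: pbar_outside)
  qed
  moreover have "(\<Sum>i\<in>UNIV. pbar $ i) = 1"
  proof -
    have "(\<Sum>i\<in>UNIV. pbar $ i) = (\<Sum>i\<in>- I k. (sqrt (\<alpha> i) / t - 1) / (2 * lams i))"
      by (rule sum.mono_neutral_cong_right) (auto simp: pbar_inside pbar_outside)
    also have "\<dots> = (\<Sum>i\<in>- I k. sqrt (\<alpha> i) / lams i / (2 * t) - 1 / lams i / 2)"
      by (simp add: diff_divide_distrib mult.commute mult.left_commute)
    also have "\<dots> = B k / (2 * t) - (A k - 2) / 2"
      by (simp add: A_def B_def sum_subtractf sum_divide_distrib)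
    \<comment> \<open>By the choice of \<open>t\<close> the first term is \<open>A k / 2\<close>;
      the summand 2 in \<open>A k\<close> is what makes the total 1.\<close>
    also have "\<dots> = 1"
      using \<open>B k > 0\<close> by (simp add: t_def field_simps)
    finally show ?thesis .
  qed
  ultimately show ?thesis
    using \<alpha>_nonneg lams_pos \<open>t > 0\<close> by (intro is_arg_max_water_filling)
qed

end
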